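(* Let $q$ be a prime power. For integers $n\ge 1$, $0\le k\le n$, $r\ge0$, let $\mathrm{mat}_0(n,k,r)$ be the number of $n\times n$ matrices over $\mathbf{F}_q$ of rank $r$ whose first $k$ diagonal entries are zero (the other diagonal entries may or may not be zero). Then for $n\ge1$, $0\le k\le n$, $r\ge 0$, $$\mathrm{mat}_0(n+1,k+1,r+1)=\frac1q\,\mathrm{mat}_0(n+1,k,r+1)+(q^{r+1}-q^r)\,\mathrm{mat}_0(n,k,r+1)-(q^r-q^{r-1})\,\mathrm{mat}_0(n,k,r),$$ with initial conditions $$\mathrm{mat}_0(n,0,r)=\frac{q^{\binom r2}(q-1)^r}{[r]_q!}\left(\prod_{i=0}^{r-1}[n-i]_q\right)^2.$$
   Context: $\mathbf{F}_q$ is the field with $q$ elements. $[n]_q=\frac{q^n-1}{q-1}$ and $[n]_q!=[n]_q[n-1]_q\cdots[1]_q$, with $[0]_q!=1$. *)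

theory Defs
  imports Complex_Main "Jordan_Normal_Form.DL_Rank"
begin

text \<open>The field with \<open>q\<close> elements is a type \<open>'a\<close> of sort \<open>{field, finite}\<close> with \<open>CARD('a) = q\<close>.
  That \<open>q\<close> is a prime power is then automatic. Matrix indices start at \<open>0\<close>, so the first \<open>k\<close>
  diagonal entries are those at the positions \<open>i < k\<close>.\<close>

definition mat0 :: "'a::{field, finite} itself \<Rightarrow> nat \<Rightarrow> nat \<Rightarrow> nat \<Rightarrow> nat" where
  "mat0 _ n k r = card {A :: 'a mat. A \<in> carrier_mat n n \<and> vec_space.rank n A = r \<and>
     (\<forall>i<k. A $$ (i, i) = 0)}"

text \<open>The argument is an integer because the factors \<open>[n - i]\<^sub>q\<close> of the initial condition have
  negative arguments when \<open>i > n\<close>.\<close>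

definition qnum :: "real \<Rightarrow> int \<Rightarrow> real" where
  "qnum q m = (q powi m - 1) / (q - 1)"

definition qfact :: "real \<Rightarrow> nat \<Rightarrow> real" where
  "qfact q n = (\<Prod>i=1..n. qnum q (int i))"

end

theory Submission
  imports Defs "Berlekamp_Zassenhaus.Berlekamp_Type_Based"
begin

text \<open>
  Write \<open>q\<close> for the number of field elements. A matrix of rank \<open>s\<close> has a column space with \<open>q ^ s\<close>
  elements (\<open>card_col_space\<close>), so ranks can be read off from cardinalities. If column \<open>k\<close> of \<open>A\<close> is
  zero, then filling in a column \<open>c\<close> keeps the rank when \<open>c\<close> lies in the column space of \<open>A\<close> and
  raises it by one otherwise (\<open>rank_put_col\<close>). Both parts of the theorem count matrices by fixing all
  columns but one and letting that column vary.

  For the recurrence, fix all columns except column \<open>k\<close> of an \<open>(n + 1) \<times> (n + 1)\<close> matrix whose first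
  \<open>k\<close> diagonal entries are zero. One would expect the next diagonal entry to be zero for one column in
  \<open>q\<close>, which is the first term of the recurrence. This is exactly right within each rank class unless row
  \<open>k\<close> of the remaining columns is zero: otherwise coordinate \<open>k\<close> is a nonzero functional on
  their column space, so it takes all values equally often there and on the complement
  (\<open>corner_balance\<close>). If row \<open>k\<close> is zero, the remaining columns form an \<open>n \<times> n\<close> matrix with a
  zero row and column inserted at \<open>k\<close>, of the same rank (\<open>card_zero_cross\<close>). The columns that lie in
  the column space then all have diagonal entry zero. For matrices of rank \<open>r + 1\<close> this bias yields
  the other two terms: a surplus when the smaller matrix already has rank \<open>r + 1\<close>, and a deficit when it
  has rank \<open>r\<close> and the column must lie outside the column space.

  For the initial condition, fill in the columns from left to right: rank \<open>s\<close> is kept by \<open>q ^ s\<close> choices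
  of the next column and raised by \<open>q ^ n - q ^ s\<close> choices. The resulting recursion is solved by
  \<open>\<Prod>i<r. (q ^ n - q ^ i) (q ^ m - q ^ i) / (q ^ r - q ^ i)\<close> for \<open>m\<close> columns
  (\<open>leading_cols_count_closed_form\<close>), which is the stated formula at \<open>m = n\<close>.
\<close>

section \<open>Cardinalities of subspaces and ranks\<close>

lemma submodule_module_vec_iff:
  fixes W :: "'a::field vec set"
  shows "submodule class_ring W (module_vec TYPE('a) n) \<longleftrightarrow>
    W \<subseteq> carrier_vec n \<and> 0\<^sub>v n \<in> W \<and> (\<forall>v\<in>W. \<forall>w\<in>W. v + w \<in> W) \<and> (\<forall>a. \<forall>v\<in>W. a \<cdot>\<^sub>v v \<in> W)"
  using vec_module[where 'a='a and n=n]
  unfolding submodule_def module_vec_simps class_ring_simps by auto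

text \<open>A vector outside \<open>W\<close> enlarges it by the factor \<open>q\<close>: if \<open>v + a u = w + b u\<close> with
  \<open>a \<noteq> b\<close>, then \<open>u = (w - v) / (a - b)\<close> would lie in \<open>W\<close>, so all these sums are distinct.\<close>
lemma card_adjoin:
  fixes W :: "'a::{field,finite} vec set"
  assumes W: "submodule class_ring W (module_vec TYPE('a) n)"
    and u: "u \<in> carrier_vec n" "u \<notin> W"
  shows "card ((\<lambda>(w, a). w + a \<cdot>\<^sub>v u) ` (W \<times> UNIV)) = card (UNIV :: 'a set) * card W"
proof -
  note W' = W[unfolded submodule_module_vec_iff]
  have "inj_on (\<lambda>(w, a). w + a \<cdot>\<^sub>v u) (W \<times> UNIV)"
  proof (rule inj_onI, clarify)
    fix v w :: "'a vec" and a b :: 'a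
    assume v: "v \<in> W" and w: "w \<in> W" and eq: "v + a \<cdot>\<^sub>v u = w + b \<cdot>\<^sub>v u"
    have vn: "v \<in> carrier_vec n" and wn: "w \<in> carrier_vec n" using v w W' by auto
    have comp: "v $ i + a * u $ i = w $ i + b * u $ i" if "i < n" for i
      using arg_cong[OF eq, of "\<lambda>x. x $ i"] that vn wn u by simp
    have ab: "a = b"
    proof (rule ccontr)
      assume ne: "a \<noteq> b"
      \<comment> \<open>The sum is written with \<open>-1\<close> as a scalar so that closure of \<open>W\<close> applies literally.\<close>
      have "u = inverse (a - b) \<cdot>\<^sub>v (w + (- 1) \<cdot>\<^sub>v v)"
        by (rule eq_vecI) (use ne vn wn u comp in \<open>auto simp: field_simps\<close>)
      moreover have "inverse (a - b) \<cdot>\<^sub>v (w + (- 1) \<cdot>\<^sub>v v) \<in> W"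
        using W' v w by blast
      ultimately show False using u by simp
    qed
    moreover have "v = w"
      by (rule eq_vecI) (use ab vn wn comp in auto)
    ultimately show "v = w \<and> a = b" by simp
  qed
  from card_image[OF this] show ?thesis
    by (simp add: card_cartesian_product mult.commute)
qed

text \<open>Each vector of an independent set lies outside the span of the vectors adjoined before it,
  so \<open>card_adjoin\<close> applies at every step.\<close>
lemma card_span_lin_indpt:
  fixes U :: "'a::{field,finite} vec set"
  assumes "finite U" "U \<subseteq> carrier_vec n"
    and "\<not> module.lin_dep class_ring (module_vec TYPE('a) n) U"
  shows "card (LinearCombinations.module.span class_ring (module_vec TYPE('a) n) U) = card (UNIV :: 'a set) ^ card U"
proof -
  interpret vec_space "TYPE('a)" n .
  show ?thesis using assms
  proof (induction U rule: finite_induct)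
    case empty
    then show ?case using span_empty by simp
  next
    case (insert u U)
    have U: "U \<subseteq> carrier_vec n" and u: "u \<in> carrier_vec n" using insert.prems by auto
    have indU: "lin_indpt U" using insert.prems(2) subset_li_is_li by blast
    have "u \<notin> span U"
      using insert.prems(2) insert.hyps lindep_span[of "insert u U"] insert.prems(1) by auto
    moreover have "span (insert u U) = (\<lambda>(w, a). w + a \<cdot>\<^sub>v u) ` (span U \<times> UNIV)" (is "?L = ?R")
    proof
      show "?L \<subseteq> ?R"
      proof
        fix x assume "x \<in> ?L"
        then obtain a where x: "x = lincomb a (insert u U)"
          using finite_span[of "insert u U"] insert by auto
        have "x = a u \<cdot>\<^sub>v u + lincomb a U"
          unfolding x using lincomb_insert2[of U a u] insert by auto
        also have "\<dots> = lincomb a U + a u \<cdot>\<^sub>v u"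
          using u U by (intro comm_add_vec[where n=n]) auto
        finally show "x \<in> ?R" using insert.hyps(1) by (auto intro!: image_eqI[of _ _ "(lincomb a U, a u)"])
      qed
      show "?R \<subseteq> ?L"
      proof clarify
        fix w a assume w: "w \<in> span U"
        have "w \<in> ?L" using w span_is_monotone[of U "insert u U"] by auto
        moreover have "a \<cdot>\<^sub>v u \<in> ?L"
          using smult_in_span[OF insert.prems(1)] span_mem[of "insert u U" u] insert.prems(1) by auto
        ultimately show "w + a \<cdot>\<^sub>v u \<in> ?L" using span_add1[of "insert u U"] insert.prems(1) by auto
      qed
    qed
    moreover have "submodule class_ring (span U) (module_vec TYPE('a) n)"
      using span_is_submodule U by simp
    ultimately show ?case
      using insert.IH[OF U indU] insert.hyps card_adjoin[of "span U" n u] u by simp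
  qed
qed

lemma submodule_col_space:
  fixes A :: "'a::field mat"
  assumes "A \<in> carrier_mat n nc"
  shows "submodule class_ring (vec_space.col_space n A) (module_vec TYPE('a) n)"
proof -
  interpret vec_space "TYPE('a)" n .
  show ?thesis unfolding col_space_def
    using span_is_submodule[of "set (cols A)"] cols_dim[of A] assms by auto
qed

text \<open>This translates ranks into cardinalities. From here on, ranks are compared by counting column
  spaces, and bases do not appear again.\<close>
lemma card_col_space:
  fixes A :: "'a::{field,finite} mat"
  assumes A: "A \<in> carrier_mat n nc"
  shows "card (vec_space.col_space n A) = card (UNIV :: 'a set) ^ vec_space.rank n A"
proof -
  interpret vec_space "TYPE('a)" n .
  have C: "set (cols A) \<subseteq> carrier_vec n" using cols_dim A by blast
  obtain U where U: "maximal U (\<lambda>T. T \<subseteq> set (cols A) \<and> lin_indpt T)" "finite U"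
    using maximal_exists_superset[of "set (cols A)" "\<lambda>T. T \<subseteq> set (cols A) \<and> lin_indpt T" "{}"]
    by (meson List.finite_set empty_subsetI finite_lin_indpt2 finite.emptyI empty_iff)
  then have UC: "U \<subseteq> set (cols A)" and ind: "lin_indpt U" unfolding maximal_def by auto
  have "c \<in> span U" if c: "c \<in> set (cols A)" for c
  proof (rule ccontr)
    assume n: "c \<notin> span U"
    have "c \<notin> U" using n span_mem[of U c] UC C by auto
    moreover have "lin_indpt (insert c U)"
      using lin_dep_iff_in_span[of U c] n c C UC ind \<open>c \<notin> U\<close> by auto
    ultimately show False
      using U(1) UC c unfolding maximal_def by blast
  qed
  then have "set (cols A) \<subseteq> span U" by (rule subsetI)
  from span_subsetI[OF subset_trans[OF UC C] this] span_is_monotone[OF UC]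
  have "span (set (cols A)) = span U" by (rule subset_antisym)
  then show ?thesis
    using card_span_lin_indpt[OF U(2) _ ind] UC C rank_card_indpt[OF A U(1)]
    unfolding col_space_def by auto
qed

lemma card_field_ge_2: "2 \<le> card (UNIV :: 'a::{field,finite} set)"
proof -
  have "card {0, 1 :: 'a} \<le> card (UNIV :: 'a set)" by (rule card_mono) auto
  then show ?thesis by simp
qed

lemma rank_eqI_card:
  fixes A :: "'a::{field,finite} mat"
  assumes "A \<in> carrier_mat n nc" "card (vec_space.col_space n A) = card (UNIV :: 'a set) ^ r"
  shows "vec_space.rank n A = r"
  using card_col_space[OF assms(1)] assms(2) card_field_ge_2[where 'a='a] by simp

text \<open>A coordinate that does not vanish identically on \<open>W\<close> takes each of its \<open>q\<close> values equally
  often, since \<open>W\<close> arises from the hyperplane section by adjoining \<open>u\<close>.\<close>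
lemma card_submodule_hyperplane:
  fixes W :: "'a::{field,finite} vec set"
  assumes W: "submodule class_ring W (module_vec TYPE('a) n)"
    and u: "u \<in> W" "u $ k \<noteq> 0" and k: "k < n"
  shows "card W = card (UNIV :: 'a set) * card {w \<in> W. w $ k = 0}"
proof -
  note W' = W[unfolded submodule_module_vec_iff]
  let ?H = "{w \<in> W. w $ k = 0}"
  have H: "submodule class_ring ?H (module_vec TYPE('a) n)"
    unfolding submodule_module_vec_iff using W' k by (auto simp: subset_iff)
  have "(\<lambda>(w, a). w + a \<cdot>\<^sub>v u) ` (?H \<times> UNIV) = W"
  proof
    show "(\<lambda>(w, a). w + a \<cdot>\<^sub>v u) ` (?H \<times> UNIV) \<subseteq> W" using W' u by auto
    show "W \<subseteq> (\<lambda>(w, a). w + a \<cdot>\<^sub>v u) ` (?H \<times> UNIV)"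
    proof
      fix w assume w: "w \<in> W"
      \<comment> \<open>Subtracting this multiple of \<open>u\<close> makes entry \<open>k\<close> vanish.\<close>
      define a where "a = w $ k / u $ k"
      let ?h = "w + (- a) \<cdot>\<^sub>v u"
      have c: "w \<in> carrier_vec n" "u \<in> carrier_vec n" using w u W' by auto
      have "?h \<in> W" using W' u w by blast
      moreover have "?h $ k = 0" using c k u by (simp add: a_def)
      moreover have "w = ?h + a \<cdot>\<^sub>v u"
        by (rule eq_vecI) (use c in auto)
      ultimately show "w \<in> (\<lambda>(w, a). w + a \<cdot>\<^sub>v u) ` (?H \<times> UNIV)"
        by (intro image_eqI[of _ _ "(?h, a)"]) auto
    qed
  qed
  with card_adjoin[OF H, of u] u W' show ?thesis by auto
qed

section \<open>Replacing one column of a matrix\<close>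

lemma finite_carrier_mat: "finite (carrier_mat nr nc :: 'a::finite mat set)"
proof -
  have "carrier_mat nr nc \<subseteq> mat_of_cols nr ` {xs :: 'a vec list. set xs \<subseteq> carrier_vec nr \<and> length xs = nc}"
  proof
    fix A :: "'a mat" assume A: "A \<in> carrier_mat nr nc"
    then have "A = mat_of_cols nr (cols A)" using mat_of_cols_cols[of A] by simp
    moreover have "set (cols A) \<subseteq> carrier_vec nr" "length (cols A) = nc" using A cols_dim[of A] by auto
    ultimately show "A \<in> mat_of_cols nr ` {xs. set xs \<subseteq> carrier_vec nr \<and> length xs = nc}" by blast
  qed
  then show ?thesis
    using finite_lists_length_eq[OF finite_carrier_vec] by (rule finite_subset[OF _ finite_imageI])
qed

text \<open>The counts below split a matrix into its column \<open>k\<close> and the rest. The rest is kept as a matrix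
  of the same size with column \<open>k\<close> zero, so that no dimension changes when a column is
  taken out or put back.\<close>
definition put_col :: "nat \<Rightarrow> 'a vec \<Rightarrow> 'a mat \<Rightarrow> 'a mat" where
  "put_col k c A = mat (dim_row A) (dim_col A) (\<lambda>(i, j). if j = k then c $ i else A $$ (i, j))"

lemma put_col_carrier [simp]: "put_col k c A \<in> carrier_mat n m \<longleftrightarrow> A \<in> carrier_mat n m"
  unfolding put_col_def carrier_mat_def by simp

lemma put_col_index:
  "A \<in> carrier_mat n m \<Longrightarrow> i < n \<Longrightarrow> j < m \<Longrightarrow>
    put_col k c A $$ (i, j) = (if j = k then c $ i else A $$ (i, j))"
  unfolding put_col_def by simp

lemma col_put_col:
  "A \<in> carrier_mat n m \<Longrightarrow> k < m \<Longrightarrow> c \<in> carrier_vec n \<Longrightarrow> col (put_col k c A) k = c"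
  by (intro eq_vecI) (auto simp: put_col_def)

lemma put_col_put_col:
  "A \<in> carrier_mat n m \<Longrightarrow> k < m \<Longrightarrow> put_col k c (put_col k d A) = put_col k c A"
  by (intro eq_matI) (auto simp: put_col_def)

lemma put_col_col: "A \<in> carrier_mat n m \<Longrightarrow> k < m \<Longrightarrow> put_col k (col A k) A = A"
  by (intro eq_matI) (auto simp: put_col_def)

lemma zero_col_entry:
  "A \<in> carrier_mat n m \<Longrightarrow> k < m \<Longrightarrow> col A k = 0\<^sub>v n \<Longrightarrow> i < n \<Longrightarrow> A $$ (i, k) = 0"
  by (metis carrier_matD index_col index_zero_vec(1))

lemma put_col_mult_vec:
  fixes A :: "'a::field mat"
  assumes A: "A \<in> carrier_mat n m" "k < m" "col A k = 0\<^sub>v n"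
    and x: "x \<in> carrier_vec m" and c: "c \<in> carrier_vec n"
  shows "put_col k c A *\<^sub>v x = A *\<^sub>v x + x $ k \<cdot>\<^sub>v c"
proof (rule eq_vecI)
  fix i assume "i < dim_vec (A *\<^sub>v x + x $ k \<cdot>\<^sub>v c)"
  then have i: "i < n" using c by simp
  have z: "A $$ (i, k) = 0" using zero_col_entry[OF A i] .
  have "(put_col k c A *\<^sub>v x) $ i = (\<Sum>j<m. (if j = k then c $ i else A $$ (i, j)) * x $ j)"
    using A i x by (simp add: scalar_prod_def put_col_def lessThan_atLeast0)
  also have "\<dots> = (\<Sum>j<m. A $$ (i, j) * x $ j + (if j = k then c $ i * x $ k else 0))"
    using z by (intro sum.cong) auto
  also have "\<dots> = (\<Sum>j<m. A $$ (i, j) * x $ j) + c $ i * x $ k"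
    using A(2) by (simp add: sum.distrib)
  also have "\<dots> = (A *\<^sub>v x + x $ k \<cdot>\<^sub>v c) $ i"
    using A i x c by (simp add: scalar_prod_def lessThan_atLeast0 mult.commute)
  finally show "(put_col k c A *\<^sub>v x) $ i = (A *\<^sub>v x + x $ k \<cdot>\<^sub>v c) $ i" .
qed (use A c in \<open>auto simp: put_col_def\<close>)

lemma col_space_iff:
  fixes A :: "'a::field mat"
  assumes "A \<in> carrier_mat n m"
  shows "vec_space.col_space n A = (\<lambda>x. A *\<^sub>v x) ` carrier_vec m"
  using assms by (auto simp: vec_space.col_space_eq[OF assms])

lemma col_space_put_col:
  fixes A :: "'a::field mat"
  assumes A: "A \<in> carrier_mat n m" "k < m" "col A k = 0\<^sub>v n" and c: "c \<in> carrier_vec n"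
  shows "vec_space.col_space n (put_col k c A) =
    (\<lambda>(w, a). w + a \<cdot>\<^sub>v c) ` (vec_space.col_space n A \<times> UNIV)" (is "?L = ?R")
proof
  have L: "?L = (\<lambda>x. put_col k c A *\<^sub>v x) ` carrier_vec m"
    by (rule col_space_iff) (use A in simp)
  show "?L \<subseteq> ?R"
    unfolding L col_space_iff[OF A(1)]
    by (auto simp: put_col_mult_vec[OF A _ c])
  show "?R \<subseteq> ?L"
  proof clarify
    fix w a assume "w \<in> vec_space.col_space n A"
    then obtain x where x: "x \<in> carrier_vec m" "w = A *\<^sub>v x"
      unfolding col_space_iff[OF A(1)] by auto
    \<comment> \<open>Entry \<open>k\<close> of \<open>x\<close> is free, since column \<open>k\<close> of \<open>A\<close> is zero: it supplies the coefficient of \<open>c\<close>.\<close>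
    define y where "y = vec m (\<lambda>j. if j = k then a else x $ j)"
    have y: "y \<in> carrier_vec m" "y $ k = a" using A(2) by (auto simp: y_def)
    have "A *\<^sub>v y = A *\<^sub>v x"
    proof (rule eq_vecI)
      fix i assume "i < dim_vec (A *\<^sub>v x)"
      then have i: "i < n" using A by simp
      have "A $$ (i, k) = 0" using zero_col_entry[OF A i] .
      then show "(A *\<^sub>v y) $ i = (A *\<^sub>v x) $ i"
        using A i x by (auto simp: scalar_prod_def y_def intro!: sum.cong)
    qed (use A in auto)
    then have "w + a \<cdot>\<^sub>v c = put_col k c A *\<^sub>v y"
      using put_col_mult_vec[OF A y(1) c] y x by simp
    then show "w + a \<cdot>\<^sub>v c \<in> ?L" unfolding L using y by blast
  qed
qed

text \<open>The column space of \<open>put_col k c A\<close> is that of \<open>A\<close> together with all multiples of \<open>c\<close>. So it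
  is unchanged or \<open>q\<close> times as large, according to whether \<open>c\<close> was already in it.\<close>
lemma rank_put_col:
  fixes A :: "'a::{field,finite} mat"
  assumes A: "A \<in> carrier_mat n m" "k < m" "col A k = 0\<^sub>v n" and c: "c \<in> carrier_vec n"
  shows "vec_space.rank n (put_col k c A) =
    vec_space.rank n A + (if c \<in> vec_space.col_space n A then 0 else 1)"
proof -
  let ?C = "vec_space.col_space n A"
  have sub: "submodule class_ring ?C (module_vec TYPE('a) n)"
    using A(1) by (rule submodule_col_space)
  note sub' = sub[unfolded submodule_module_vec_iff]
  have "card (vec_space.col_space n (put_col k c A)) =
      card (UNIV :: 'a set) ^ (vec_space.rank n A + (if c \<in> ?C then 0 else 1))"
  proof (cases "c \<in> ?C")
    case True
    have "(\<lambda>(w, a). w + a \<cdot>\<^sub>v c) ` (?C \<times> UNIV) = ?C"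
    proof
      show "(\<lambda>(w, a). w + a \<cdot>\<^sub>v c) ` (?C \<times> UNIV) \<subseteq> ?C" using sub' True by auto
      show "?C \<subseteq> (\<lambda>(w, a). w + a \<cdot>\<^sub>v c) ` (?C \<times> UNIV)"
      proof
        fix w assume w: "w \<in> ?C"
        then have "w + 0 \<cdot>\<^sub>v c = w" using sub' c by (intro eq_vecI) auto
        then show "w \<in> (\<lambda>(w, a). w + a \<cdot>\<^sub>v c) ` (?C \<times> UNIV)"
          using w by (intro image_eqI[of _ _ "(w, 0)"]) simp_all
      qed
    qed
    then show ?thesis using True card_col_space[OF A(1)] by (simp add: col_space_put_col[OF A c])
  next
    case False
    then show ?thesis
      using card_adjoin[OF sub c False] card_col_space[OF A(1)]
      by (simp add: col_space_put_col[OF A c])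
  qed
  then show ?thesis by (rule rank_eqI_card[OF put_col_carrier[THEN iffD2, OF A(1)]])
qed

text \<open>Matrices are counted by fibring over their part outside column \<open>k\<close>. The condition \<open>P\<close> sees only
  that part, and \<open>Q\<close> sees only the column, so \<open>Q\<close> and the rank are left to the fibre.\<close>
lemma card_put_col_fibres:
  fixes P :: "'a::{field,finite} mat \<Rightarrow> bool" and Q :: "'a vec \<Rightarrow> bool"
  assumes k: "k < m"
  shows "card {A \<in> carrier_mat n m. P (put_col k (0\<^sub>v n) A) \<and> Q (col A k) \<and> vec_space.rank n A = r} =
    (\<Sum>A \<in> {A \<in> carrier_mat n m. col A k = 0\<^sub>v n \<and> P A}.
       card {c \<in> carrier_vec n. Q c \<and> vec_space.rank n (put_col k c A) = r})"
    (is "card ?L = (\<Sum>A\<in>?T. card (?F A))")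
proof -
  have "bij_betw (\<lambda>(A, c). put_col k c A) (SIGMA A:?T. ?F A) ?L"
  proof (rule bij_betw_byWitness[where f' = "\<lambda>A. (put_col k (0\<^sub>v n) A, col A k)"])
    have recover_pair: "put_col k (0\<^sub>v n) (put_col k c A) = A" "col (put_col k c A) k = c"
      if "A \<in> carrier_mat n m" "col A k = 0\<^sub>v n" "c \<in> carrier_vec n" for A :: "'a mat" and c
    proof -
      show "put_col k (0\<^sub>v n) (put_col k c A) = A"
        using put_col_col[OF that(1) k] unfolding put_col_put_col[OF that(1) k] that(2) .
      show "col (put_col k c A) k = c" by (rule col_put_col[OF that(1) k that(3)])
    qed
    have recover_mat: "put_col k (col A k) (put_col k (0\<^sub>v n) A) = A" "col (put_col k (0\<^sub>v n) A) k = 0\<^sub>v n"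
      "col A k \<in> carrier_vec n" if "A \<in> carrier_mat n m" for A :: "'a mat"
    proof -
      show "put_col k (col A k) (put_col k (0\<^sub>v n) A) = A"
        using put_col_col[OF that k] unfolding put_col_put_col[OF that k] .
      show "col (put_col k (0\<^sub>v n) A) k = 0\<^sub>v n"
        by (rule col_put_col[OF that k zero_carrier_vec])
      show "col A k \<in> carrier_vec n" using col_dim[of A k] that by (simp add: carrier_matD(1))
    qed
    show "\<forall>a\<in>SIGMA A:?T. ?F A.
      (put_col k (0\<^sub>v n) (case a of (A, c) \<Rightarrow> put_col k c A), col (case a of (A, c) \<Rightarrow> put_col k c A) k) = a"
    proof
      fix a assume "a \<in> (SIGMA A:?T. ?F A)"
      then obtain A c where a: "a = (A, c)" and "A \<in> ?T" "c \<in> ?F A" by (rule SigmaE)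
      then show "(put_col k (0\<^sub>v n) (case a of (A, c) \<Rightarrow> put_col k c A),
          col (case a of (A, c) \<Rightarrow> put_col k c A) k) = a"
        unfolding a prod.case using recover_pair[of A c] by simp
    qed
    show "\<forall>A\<in>?L. (case (put_col k (0\<^sub>v n) A, col A k) of (A, c) \<Rightarrow> put_col k c A) = A"
      unfolding prod.case using recover_mat(1) by simp
    show "(\<lambda>(A, c). put_col k c A) ` (SIGMA A:?T. ?F A) \<subseteq> ?L"
    proof (rule image_subsetI)
      fix a assume "a \<in> (SIGMA A:?T. ?F A)"
      then obtain A c where a: "a = (A, c)" and A: "A \<in> ?T" and c: "c \<in> ?F A" by (rule SigmaE)
      show "(case a of (A, c) \<Rightarrow> put_col k c A) \<in> ?L"
        unfolding a prod.case using recover_pair[of A c] A c by simp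
    qed
    show "(\<lambda>A. (put_col k (0\<^sub>v n) A, col A k)) ` ?L \<subseteq> (SIGMA A:?T. ?F A)"
    proof (rule image_subsetI)
      fix A assume "A \<in> ?L"
      then show "(put_col k (0\<^sub>v n) A, col A k) \<in> (SIGMA A:?T. ?F A)"
        using recover_mat[of A] by simp
    qed
  qed
  from bij_betw_same_card[OF this] have "card ?L = card (SIGMA A:?T. ?F A)" by (rule sym)
  also have "\<dots> = (\<Sum>A\<in>?T. card (?F A))"
    by (intro card_SigmaI finite_subset[OF _ finite_carrier_mat[of n m]] ballI
        finite_subset[OF _ finite_carrier_vec[of n]]) auto
  finally show ?thesis .
qed

lemma card_columns_with_rank:
  fixes A :: "'a::{field,finite} mat"
  assumes A: "A \<in> carrier_mat n m" "k < m" "col A k = 0\<^sub>v n" and H: "H \<subseteq> carrier_vec n"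
  shows "int (card {c \<in> H. vec_space.rank n (put_col k c A) = r}) =
    (if r = vec_space.rank n A then int (card (H \<inter> vec_space.col_space n A))
     else if r = Suc (vec_space.rank n A) then int (card H) - int (card (H \<inter> vec_space.col_space n A))
     else 0)"
proof -
  let ?C = "vec_space.col_space n A" and ?s = "vec_space.rank n A"
  have "{c \<in> H. vec_space.rank n (put_col k c A) = r} =
      {c \<in> H. ?s + (if c \<in> ?C then 0 else 1) = r}"
    using rank_put_col[OF A] H by (intro Collect_cong conj_cong) auto
  also have "\<dots> = (if r = ?s then H \<inter> ?C else if r = Suc ?s then H - H \<inter> ?C else {})"
    by (auto split: if_splits)
  moreover have "finite H" using H finite_carrier_vec by (rule finite_subset)
  moreover have "card (H \<inter> ?C) \<le> card H" using \<open>finite H\<close> by (intro card_mono) auto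
  ultimately show ?thesis by (simp add: card_Diff_subset of_nat_diff)
qed

section \<open>The bias of a diagonal entry\<close>

lemma row_zero_iff_col_space:
  fixes A :: "'a::field mat"
  assumes A: "A \<in> carrier_mat n m" and k: "k < n"
  shows "row A k = 0\<^sub>v m \<longleftrightarrow> (\<forall>w \<in> vec_space.col_space n A. w $ k = 0)"
proof
  assume z: "row A k = 0\<^sub>v m"
  show "\<forall>w \<in> vec_space.col_space n A. w $ k = 0"
  proof
    fix w assume "w \<in> vec_space.col_space n A"
    then obtain x where "x \<in> carrier_vec m" "w = A *\<^sub>v x" unfolding col_space_iff[OF A] by blast
    then show "w $ k = 0" using A k z by simp
  qed
next
  assume z: "\<forall>w \<in> vec_space.col_space n A. w $ k = 0"
  show "row A k = 0\<^sub>v m"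
  proof (rule eq_vecI)
    fix j assume "j < dim_vec (0\<^sub>v m :: 'a vec)"
    then have j: "j < m" by simp
    have "A *\<^sub>v unit_vec m j \<in> vec_space.col_space n A" unfolding col_space_iff[OF A] by simp
    then have "(A *\<^sub>v unit_vec m j) $ k = 0" using z by blast
    moreover have "(A *\<^sub>v unit_vec m j) $ k = row A k $ j"
      using A k j by simp
    ultimately show "row A k $ j = 0\<^sub>v m $ j" using j by simp
  qed (use A in simp)
qed

text \<open>The heart of the recurrence: how far the entry \<open>(k, k)\<close> of a matrix of rank \<open>r\<close> is from being
  zero with probability exactly \<open>1/q\<close>, when the other columns are given. The vectors \<open>c\<close> with
  \<open>c $ k = 0\<close> are a fraction \<open>1/q\<close> of all vectors. If row \<open>k\<close> of \<open>A\<close> is nonzero, then coordinate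
  \<open>k\<close> does not vanish on the column space \<open>C\<close>, so they are also a fraction \<open>1/q\<close> of \<open>C\<close>, hence of
  its complement, and there is no bias. If row \<open>k\<close> is zero, all of \<open>C\<close> has \<open>c $ k = 0\<close>; the
  columns in \<open>C\<close> give a surplus of \<open>q |C| - |C|\<close>, and the columns outside \<open>C\<close> give the opposite
  deficit.\<close>
lemma corner_balance:
  fixes A :: "'a::{field,finite} mat" and q :: int
  assumes A: "A \<in> carrier_mat n m" "k < m" "col A k = 0\<^sub>v n" and k: "k < n"
    and q: "q = int (card (UNIV :: 'a set))"
  shows "q * int (card {c \<in> carrier_vec n. c $ k = 0 \<and> vec_space.rank n (put_col k c A) = r})
      - int (card {c \<in> carrier_vec n. vec_space.rank n (put_col k c A) = r}) =
    (if row A k = 0\<^sub>v m then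
       if vec_space.rank n A = r then q ^ Suc r - q ^ r
       else if Suc (vec_space.rank n A) = r then q ^ (r - 1) - q ^ r else 0
     else 0)"
proof -
  let ?C = "vec_space.col_space n A" and ?s = "vec_space.rank n A"
  let ?V = "carrier_vec n :: 'a vec set"
  let ?H = "{c \<in> ?V. c $ k = 0}"
  have sub: "submodule class_ring ?C (module_vec TYPE('a) n)"
    using A(1) by (rule submodule_col_space)
  then have CV: "?C \<subseteq> ?V" unfolding submodule_module_vec_iff by simp
  have cC: "int (card ?C) = q ^ ?s" using card_col_space[OF A(1)] q by simp
  have cV: "int (card ?V) = q ^ n" using card_carrier_vec[of n, where 'b='a] q by simp
  have "submodule class_ring ?V (module_vec TYPE('a) n)"
    unfolding submodule_module_vec_iff by simp
  from card_submodule_hyperplane[OF this, of "unit_vec n k" k] k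
  have cH: "q * int (card ?H) = q ^ n" using cV q by simp
  have HC: "?H \<inter> ?C = {w \<in> ?C. w $ k = 0}" using CV by auto
  have VC: "?V \<inter> ?C = ?C" using CV by auto
  have hyp: "{c \<in> ?V. c $ k = 0 \<and> vec_space.rank n (put_col k c A) = r} =
      {c \<in> ?H. vec_space.rank n (put_col k c A) = r}" by auto
  have all: "int (card {c \<in> ?V. vec_space.rank n (put_col k c A) = r}) =
      (if r = ?s then q ^ ?s else if r = Suc ?s then q ^ n - q ^ ?s else 0)"
    unfolding card_columns_with_rank[OF A subset_refl] VC cC cV ..
  have zero: "int (card {c \<in> ?V. c $ k = 0 \<and> vec_space.rank n (put_col k c A) = r}) =
      (if r = ?s then int (card (?H \<inter> ?C))
       else if r = Suc ?s then int (card ?H) - int (card (?H \<inter> ?C)) else 0)"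
    unfolding hyp by (rule card_columns_with_rank[OF A]) auto
  show ?thesis
  proof (cases "row A k = 0\<^sub>v m")
    case True
    then have "\<forall>w\<in>?C. w $ k = 0" using row_zero_iff_col_space[OF A(1) k] by blast
    then have "?H \<inter> ?C = ?C" unfolding HC by blast
    then have "int (card (?H \<inter> ?C)) = q ^ ?s" using cC by simp
    then show ?thesis using True cH unfolding all zero
      by (auto simp: right_diff_distrib)
  next
    case False
    then obtain u where u: "u \<in> ?C" "u $ k \<noteq> 0" using row_zero_iff_col_space[OF A(1) k] by blast
    have "int (card ?C) = q * int (card (?H \<inter> ?C))"
      using arg_cong[OF card_submodule_hyperplane[OF sub u k], of int] by (simp add: HC q)
    then have "q * int (card (?H \<inter> ?C)) = q ^ ?s" using cC by simp
    then show ?thesis using False cH unfolding all zero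
      by (auto simp: right_diff_distrib)
  qed
qed

section \<open>Deleting a zero row and column\<close>

text \<open>The vector analogue of \<open>mat_delete\<close>.\<close>
definition del_entry :: "nat \<Rightarrow> 'a vec \<Rightarrow> 'a vec" where
  "del_entry k v = vec (dim_vec v - 1) (\<lambda>i. v $ insert_index k i)"

lemma insert_index_less: "i < n \<Longrightarrow> insert_index k i < Suc n"
  by (simp add: insert_index_def)

lemma delete_index_less: "i < Suc n \<Longrightarrow> i \<noteq> k \<Longrightarrow> k < Suc n \<Longrightarrow> delete_index k i < n"
  by (auto simp: delete_index_def)

text \<open>Column \<open>k\<close> is zero, so the entry of \<open>x\<close> that is deleted does not contribute to \<open>A x\<close>.\<close>
lemma mat_delete_mult_vec:
  fixes A :: "'a::field mat"
  assumes A: "A \<in> carrier_mat (Suc n) (Suc n)" and k: "k < Suc n"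
    and col: "col A k = 0\<^sub>v (Suc n)" and x: "x \<in> carrier_vec (Suc n)"
  shows "mat_delete A k k *\<^sub>v del_entry k x = del_entry k (A *\<^sub>v x)"
proof (rule eq_vecI)
  have D: "mat_delete A k k \<in> carrier_mat n n" using mat_delete_carrier[OF A, of k k] by simp
  fix i assume "i < dim_vec (del_entry k (A *\<^sub>v x))"
  then have i: "i < n" using A by (simp add: del_entry_def)
  let ?i = "insert_index k i"
  have "(mat_delete A k k *\<^sub>v del_entry k x) $ i =
      (\<Sum>j\<in>{0..<n}. A $$ (?i, insert_index k j) * x $ insert_index k j)"
    using A i x by (simp add: scalar_prod_def del_entry_def mat_delete_index[OF A k k i])
  also have "\<dots> = (\<Sum>j\<in>insert_index k ` {0..<n}. A $$ (?i, j) * x $ j)"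
    by (simp add: sum.reindex[OF insert_index_inj_on])
  also have "\<dots> = (\<Sum>j\<in>{0..<Suc n}. A $$ (?i, j) * x $ j)"
    unfolding insert_index_image[OF k]
    using zero_col_entry[OF A k col insert_index_less[OF i]]
    by (intro sum.mono_neutral_left) auto
  also have "\<dots> = del_entry k (A *\<^sub>v x) $ i"
    using A i x insert_index_less[OF i] by (simp add: scalar_prod_def del_entry_def)
  finally show "(mat_delete A k k *\<^sub>v del_entry k x) $ i = del_entry k (A *\<^sub>v x) $ i" .
qed (use A in \<open>simp add: del_entry_def\<close>)

lemma del_entry_carrier_image:
  assumes k: "k < Suc n"
  shows "del_entry k ` carrier_vec (Suc n) = (carrier_vec n :: 'a::zero vec set)"
proof
  show "del_entry k ` carrier_vec (Suc n) \<subseteq> (carrier_vec n :: 'a vec set)"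
  proof (rule image_subsetI)
    fix v :: "'a vec" assume "v \<in> carrier_vec (Suc n)"
    then have "dim_vec v = Suc n" by (rule carrier_vecD)
    then show "del_entry k v \<in> carrier_vec n" by (intro carrier_vecI) (simp add: del_entry_def)
  qed
  show "(carrier_vec n :: 'a vec set) \<subseteq> del_entry k ` carrier_vec (Suc n)"
  proof
    fix y :: "'a vec" assume y: "y \<in> carrier_vec n"
    let ?x = "vec (Suc n) (\<lambda>i. if i = k then 0 else y $ delete_index k i)"
    have "del_entry k ?x = y"
      using y by (intro eq_vecI) (simp_all add: del_entry_def insert_index_less)
    then show "y \<in> del_entry k ` carrier_vec (Suc n)"
      by (intro image_eqI[of _ _ ?x]) (rule sym, assumption, rule vec_carrier)
  qed
qed

text \<open>When row \<open>k\<close> is zero, every vector of the column space has entry \<open>0\<close> at \<open>k\<close>, so deleting this entry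
  loses nothing: it is a bijection between the two column spaces.\<close>
lemma rank_mat_delete_zero_cross:
  fixes A :: "'a::{field,finite} mat"
  assumes A: "A \<in> carrier_mat (Suc n) (Suc n)" and k: "k < Suc n"
    and col: "col A k = 0\<^sub>v (Suc n)" and row: "row A k = 0\<^sub>v (Suc n)"
  shows "vec_space.rank n (mat_delete A k k) = vec_space.rank (Suc n) A"
proof -
  have D: "mat_delete A k k \<in> carrier_mat n n" using mat_delete_carrier[OF A, of k k] by simp
  let ?C = "vec_space.col_space (Suc n) A"
  have CV: "?C \<subseteq> carrier_vec (Suc n)"
    using submodule_col_space[OF A] unfolding submodule_module_vec_iff by simp
  have zk: "\<forall>w\<in>?C. w $ k = 0" using row_zero_iff_col_space[OF A k] row by blast
  have "vec_space.col_space n (mat_delete A k k) = (\<lambda>x. mat_delete A k k *\<^sub>v del_entry k x) ` carrier_vec (Suc n)"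
    unfolding col_space_iff[OF D] del_entry_carrier_image[OF k, symmetric] image_image ..
  also have "\<dots> = del_entry k ` ?C"
    unfolding col_space_iff[OF A] image_image
    by (rule image_cong[OF refl]) (rule mat_delete_mult_vec[OF A k col])
  finally have eq: "vec_space.col_space n (mat_delete A k k) = del_entry k ` ?C" .
  have "inj_on (del_entry k) ?C"
  proof (rule inj_onI)
    fix v w assume v: "v \<in> ?C" and w: "w \<in> ?C" and e: "del_entry k v = del_entry k w"
    have vc: "v \<in> carrier_vec (Suc n)" and wc: "w \<in> carrier_vec (Suc n)" using v w CV by auto
    show "v = w"
    proof (rule eq_vecI)
      fix i assume "i < dim_vec w"
      then have i: "i < Suc n" using wc by simp
      show "v $ i = w $ i"
      proof (cases "i = k")
        case True
        then show ?thesis using zk v w by simp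
      next
        case False
        have l: "delete_index k i < n" by (rule delete_index_less[OF i False k])
        from arg_cong[OF e, of "\<lambda>u. u $ delete_index k i"] show ?thesis
          using l vc wc by (simp add: del_entry_def insert_delete_index[OF False])
      qed
    qed (use vc wc in simp)
  qed
  from card_image[OF this]
  have "card (vec_space.col_space n (mat_delete A k k)) = card (UNIV :: 'a set) ^ vec_space.rank (Suc n) A"
    unfolding eq card_col_space[OF A, symmetric] .
  then show ?thesis by (rule rank_eqI_card[OF D])
qed

text \<open>The matrices that carry the bias in \<open>corner_balance\<close> have row and column \<open>k\<close> zero. They are the
  smaller matrices with a zero cross inserted. Since \<open>k\<close> is the first position after the
  constrained diagonal entries, those entries keep their indices.\<close>
lemma card_zero_cross:
  assumes k: "k \<le> n"
  shows "card {A :: 'a::{field,finite} mat. A \<in> carrier_mat (Suc n) (Suc n) \<and> col A k = 0\<^sub>v (Suc n) \<and>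
      row A k = 0\<^sub>v (Suc n) \<and> (\<forall>i<k. A $$ (i, i) = 0) \<and> vec_space.rank (Suc n) A = r} =
    mat0 TYPE('a) n k r" (is "card ?L = _")
proof -
  let ?R = "{B :: 'a mat. B \<in> carrier_mat n n \<and> vec_space.rank n B = r \<and> (\<forall>i<k. B $$ (i, i) = 0)}"
  have k': "k < Suc n" using k by simp
  define pad where "pad B = mat (Suc n) (Suc n) (\<lambda>(i, j). if i = k \<or> j = k then 0
      else B $$ (delete_index k i, delete_index k j))" for B :: "'a mat"
  have pad_carrier: "pad B \<in> carrier_mat (Suc n) (Suc n)" for B by (simp add: pad_def)
  have pad_cross: "col (pad B) k = 0\<^sub>v (Suc n)" "row (pad B) k = 0\<^sub>v (Suc n)" for B
    using k' by (auto simp: pad_def intro!: eq_vecI)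
  have delete_pad: "mat_delete (pad B) k k = B" if "B \<in> carrier_mat n n" for B
  proof (rule eq_matI)
    fix i j assume "i < dim_row B" "j < dim_col B"
    then have ij: "i < n" "j < n" using that by auto
    have "mat_delete (pad B) k k $$ (i, j) = pad B $$ (insert_index k i, insert_index k j)"
      by (rule mat_delete_index[OF pad_carrier k' k' ij, symmetric])
    also have "\<dots> = B $$ (i, j)"
      using ij by (simp add: pad_def insert_index_less)
    finally show "mat_delete (pad B) k k $$ (i, j) = B $$ (i, j)" .
  qed (use that pad_carrier[of B] in auto)
  have pad_delete: "pad (mat_delete A k k) = A" if "A \<in> ?L" for A
  proof (rule eq_matI)
    have A: "A \<in> carrier_mat (Suc n) (Suc n)" "col A k = 0\<^sub>v (Suc n)" "row A k = 0\<^sub>v (Suc n)"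
      using that by auto
    fix i j assume "i < dim_row A" "j < dim_col A"
    then have ij: "i < Suc n" "j < Suc n" using A by auto
    show "pad (mat_delete A k k) $$ (i, j) = A $$ (i, j)"
    proof (cases "i = k \<or> j = k")
      case True
      then have "A $$ (i, j) = 0"
        using zero_col_entry[OF A(1) k' A(2) ij(1)] arg_cong[OF A(3), of "\<lambda>v. v $ j"] A(1) ij k' by auto
      then show ?thesis using True ij by (simp add: pad_def)
    next
      case False
      then have ne: "i \<noteq> k" "j \<noteq> k" by auto
      have "mat_delete A k k $$ (delete_index k i, delete_index k j) = A $$ (i, j)"
        using mat_delete_index[OF A(1) k' k' delete_index_less[OF ij(1) ne(1) k'] delete_index_less[OF ij(2) ne(2) k']]
        by (simp add: insert_delete_index[OF ne(1)] insert_delete_index[OF ne(2)])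
      then show ?thesis using False ij by (simp add: pad_def)
    qed
  qed (use that pad_carrier[of "mat_delete A k k"] in auto)
  have rank_pad: "vec_space.rank (Suc n) (pad B) = vec_space.rank n B" if "B \<in> carrier_mat n n" for B
    using rank_mat_delete_zero_cross[OF pad_carrier k' pad_cross, of B] delete_pad[OF that] by simp
  have diag: "mat_delete A k k $$ (i, i) = A $$ (i, i)" if "A \<in> carrier_mat (Suc n) (Suc n)" "i < k" for A i
    using mat_delete_index[OF that(1) k' k', of i i] that(2) k by simp
  have "bij_betw (\<lambda>A. mat_delete A k k) ?L ?R"
  proof (rule bij_betw_byWitness[where f' = pad])
    show "\<forall>A\<in>?L. pad (mat_delete A k k) = A" using pad_delete by (rule ballI)
    show "\<forall>B\<in>?R. mat_delete (pad B) k k = B" using delete_pad by simp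
    show "(\<lambda>A. mat_delete A k k) ` ?L \<subseteq> ?R"
    proof (rule image_subsetI)
      fix A assume "A \<in> ?L"
      then show "mat_delete A k k \<in> ?R"
        using rank_mat_delete_zero_cross[of A n k] k' mat_delete_carrier[of A "Suc n" "Suc n" k k]
        by (simp add: diag)
    qed
    show "pad ` ?R \<subseteq> ?L"
    proof (rule image_subsetI)
      fix B assume "B \<in> ?R"
      then show "pad B \<in> ?L"
        using pad_carrier[of B] pad_cross[of B] rank_pad[of B] diag[of "pad B"] delete_pad[of B] by simp
    qed
  qed
  from bij_betw_same_card[OF this] show ?thesis unfolding mat0_def .
qed

section \<open>The recurrence\<close>

lemma sum_two_values:
  fixes f :: "'b \<Rightarrow> nat" and u v :: int
  assumes "finite T" "a \<noteq> b"
  shows "(\<Sum>x\<in>T. if f x = a then u else if f x = b then v else 0) =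
    u * int (card {x \<in> T. f x = a}) + v * int (card {x \<in> T. f x = b})"
proof -
  have "(\<Sum>x\<in>T. if f x = a then u else if f x = b then v else 0) =
      (\<Sum>x\<in>T. (if f x = a then u else 0) + (if f x = b then v else 0))"
    using assms(2) by (intro sum.cong) auto
  also have "\<dots> = (\<Sum>x\<in>T. if f x = a then u else 0) + (\<Sum>x\<in>T. if f x = b then v else 0)"
    by (rule sum.distrib)
  finally show ?thesis
    unfolding sum.inter_filter[OF assms(1), symmetric] by simp
qed

text \<open>The recurrence multiplied by \<open>q\<close>. The left-hand side is the sum of the biases of
  \<open>corner_balance\<close> over all matrices whose column \<open>k\<close> and first
  \<open>k\<close> diagonal entries are zero. Only those with row \<open>k\<close> zero as well
  contribute, with a weight that depends only on whether their rank is \<open>r + 1\<close> or \<open>r\<close>, and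
  \<open>card_zero_cross\<close> counts them.\<close>
lemma mat0_recurrence_int:
  fixes q :: int
  assumes q: "q = int (card (UNIV :: 'a::{field,finite} set))" and k: "k \<le> n"
  shows "q * int (mat0 TYPE('a) (Suc n) (Suc k) (Suc r)) - int (mat0 TYPE('a) (Suc n) k (Suc r)) =
    (q ^ (r + 2) - q ^ Suc r) * int (mat0 TYPE('a) n k (Suc r))
    - (q ^ Suc r - q ^ r) * int (mat0 TYPE('a) n k r)"
proof -
  let ?N = "Suc n"
  let ?M = "carrier_mat ?N ?N :: 'a mat set"
  let ?rk = "vec_space.rank ?N :: 'a mat \<Rightarrow> nat"
  let ?P = "\<lambda>A :: 'a mat. \<forall>i<k. A $$ (i, i) = 0"
  let ?T = "{A \<in> ?M. col A k = 0\<^sub>v ?N \<and> ?P A}"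
  let ?X = "{A \<in> ?T. row A k = 0\<^sub>v ?N}"
  have k': "k < ?N" using k by simp
  have fin: "finite ?T" by (rule finite_subset[OF _ finite_carrier_mat[of ?N ?N]]) auto
  have P: "?P (put_col k (0\<^sub>v ?N) A) \<longleftrightarrow> ?P A" if "A \<in> ?M" for A
    using put_col_index[OF that] k by simp
  have diag: "(\<forall>i<Suc k. A $$ (i, i) = 0) \<longleftrightarrow> ?P A \<and> col A k $ k = 0" if "A \<in> ?M" for A :: "'a mat"
    using that k' by (auto simp: less_Suc_eq)
  have "{A \<in> ?M. ?rk A = Suc r \<and> (\<forall>i<Suc k. A $$ (i, i) = 0)} =
      {A \<in> ?M. ?P (put_col k (0\<^sub>v ?N) A) \<and> col A k $ k = 0 \<and> ?rk A = Suc r}"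
    using P diag by blast
  then have zero: "mat0 TYPE('a) ?N (Suc k) (Suc r) =
      (\<Sum>A\<in>?T. card {c \<in> carrier_vec ?N. c $ k = 0 \<and> ?rk (put_col k c A) = Suc r})"
    unfolding mat0_def card_put_col_fibres[OF k', symmetric] by (rule arg_cong)
  have "{A \<in> ?M. ?rk A = Suc r \<and> ?P A} =
      {A \<in> ?M. ?P (put_col k (0\<^sub>v ?N) A) \<and> True \<and> ?rk A = Suc r}"
    using P by blast
  then have "mat0 TYPE('a) ?N k (Suc r) =
      (\<Sum>A\<in>?T. card {c \<in> carrier_vec ?N. True \<and> ?rk (put_col k c A) = Suc r})"
    unfolding mat0_def card_put_col_fibres[OF k', symmetric] by (rule arg_cong)
  then have all: "mat0 TYPE('a) ?N k (Suc r) =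
      (\<Sum>A\<in>?T. card {c \<in> carrier_vec ?N. ?rk (put_col k c A) = Suc r})"
    unfolding simp_thms .
  have level: "card {A \<in> ?X. ?rk A = s} = mat0 TYPE('a) n k s" for s
    unfolding card_zero_cross[OF k, symmetric] by (rule arg_cong[of _ _ card]) blast
  let ?g = "\<lambda>A. if ?rk A = Suc r then q ^ (r + 2) - q ^ Suc r
      else if ?rk A = r then q ^ r - q ^ Suc r else 0"
  have "q * int (mat0 TYPE('a) ?N (Suc k) (Suc r)) - int (mat0 TYPE('a) ?N k (Suc r)) =
      (\<Sum>A\<in>?T. q * int (card {c \<in> carrier_vec ?N. c $ k = 0 \<and> ?rk (put_col k c A) = Suc r})
        - int (card {c \<in> carrier_vec ?N. ?rk (put_col k c A) = Suc r}))"
    unfolding zero all sum_subtractf sum_distrib_left[symmetric] of_nat_sum ..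
  also have "\<dots> = (\<Sum>A\<in>?T. if row A k = 0\<^sub>v ?N then ?g A else 0)"
  proof (rule sum.cong[OF refl])
    fix A assume "A \<in> ?T"
    then have A: "A \<in> ?M" "col A k = 0\<^sub>v ?N" by auto
    show "q * int (card {c \<in> carrier_vec ?N. c $ k = 0 \<and> ?rk (put_col k c A) = Suc r})
        - int (card {c \<in> carrier_vec ?N. ?rk (put_col k c A) = Suc r}) =
        (if row A k = 0\<^sub>v ?N then ?g A else 0)"
      unfolding corner_balance[OF A(1) k' A(2) k' q] by simp
  qed
  also have "\<dots> = sum ?g ?X"
    by (rule sum.inter_filter[OF fin, symmetric])
  also have "\<dots> = (q ^ (r + 2) - q ^ Suc r) * int (card {A \<in> ?X. ?rk A = Suc r})
      + (q ^ r - q ^ Suc r) * int (card {A \<in> ?X. ?rk A = r})"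
    by (intro sum_two_values finite_subset[OF _ fin]) auto
  finally show ?thesis unfolding level by (simp add: algebra_simps)
qed

section \<open>Matrices of given rank\<close>

text \<open>In effect the number of \<open>n \<times> m\<close> matrices of rank \<open>r\<close>, for \<open>m \<le> n\<close>. Padding them with zero
  columns to size \<open>n \<times> n\<close> makes the passage from \<open>m\<close> to \<open>m + 1\<close> an instance of \<open>put_col\<close>.\<close>
definition leading_cols_count :: "'a::{field,finite} itself \<Rightarrow> nat \<Rightarrow> nat \<Rightarrow> nat \<Rightarrow> nat" where
  "leading_cols_count _ n m r = card {A :: 'a mat. A \<in> carrier_mat n n \<and>
     (\<forall>j. m \<le> j \<and> j < n \<longrightarrow> col A j = 0\<^sub>v n) \<and> vec_space.rank n A = r}"

lemma leading_cols_count_full: "leading_cols_count TYPE('a::{field,finite}) n n r = mat0 TYPE('a) n 0 r"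
  unfolding leading_cols_count_def mat0_def by (rule arg_cong[of _ _ card]) auto

lemma rank_zero_mat:
  "vec_space.rank n (0\<^sub>m n m :: 'a::{field,finite} mat) = 0"
proof -
  have "vec_space.col_space n (0\<^sub>m n m :: 'a mat) = (\<lambda>x. 0\<^sub>m n m *\<^sub>v x) ` carrier_vec m"
    by (rule col_space_iff) simp
  also have "\<dots> = (\<lambda>x. 0\<^sub>v n) ` (carrier_vec m :: 'a vec set)"
    by (intro image_cong[OF refl] eq_vecI) auto
  also have "\<dots> = {0\<^sub>v n}"
    using zero_carrier_vec[of m, where 'a='a] by blast
  finally show ?thesis by (intro rank_eqI_card[of _ n m]) simp_all
qed

lemma leading_cols_count_0:
  "leading_cols_count TYPE('a::{field,finite}) n 0 r = (if r = 0 then 1 else 0)"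
proof -
  let ?S = "{A :: 'a mat. A \<in> carrier_mat n n \<and> (\<forall>j. 0 \<le> j \<and> j < n \<longrightarrow> col A j = 0\<^sub>v n) \<and>
      vec_space.rank n A = r}"
  have zero: "A = 0\<^sub>m n n" if A: "A \<in> ?S" for A
  proof (rule eq_matI)
    have A': "A \<in> carrier_mat n n" "\<forall>j. 0 \<le> j \<and> j < n \<longrightarrow> col A j = 0\<^sub>v n" using A by simp_all
    then show "dim_row A = dim_row (0\<^sub>m n n :: 'a mat)" "dim_col A = dim_col (0\<^sub>m n n :: 'a mat)"
      by simp_all
    fix i j assume "i < dim_row (0\<^sub>m n n :: 'a mat)" "j < dim_col (0\<^sub>m n n :: 'a mat)"
    then have ij: "i < n" "j < n" by auto
    then show "A $$ (i, j) = 0\<^sub>m n n $$ (i, j)"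
      using zero_col_entry[OF A'(1) ij(2) _ ij(1)] A'(2) by simp
  qed
  have "?S = (if r = 0 then {0\<^sub>m n n} else {})"
  proof (cases "r = 0")
    case True
    have "0\<^sub>m n n \<in> ?S" using rank_zero_mat[of n n, where 'a='a] True by simp
    moreover have "?S \<subseteq> {0\<^sub>m n n}" by (rule subsetI) (simp only: singleton_iff zero)
    ultimately have "?S = {0\<^sub>m n n}" by (intro subset_antisym) simp_all
    then show ?thesis using True by simp
  next
    case False
    have "A \<notin> ?S" for A
    proof
      assume A: "A \<in> ?S"
      then have "vec_space.rank n A = r" by simp
      then show False using False unfolding zero[OF A] rank_zero_mat by simp
    qed
    then have "?S = {}" by blast
    then show ?thesis using False by simp
  qed
  then show ?thesis unfolding leading_cols_count_def by simp
qed

text \<open>A new column either lies in the column space, which has \<open>q ^ s\<close> elements for rank \<open>s\<close>, or is one of the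
  \<open>q ^ n - q ^ s\<close> others and raises the rank by one.\<close>
lemma leading_cols_count_Suc:
  fixes q :: int
  assumes q: "q = int (card (UNIV :: 'a::{field,finite} set))" and m: "m < n"
  shows "int (leading_cols_count TYPE('a) n (Suc m) 0) = int (leading_cols_count TYPE('a) n m 0)"
    and "int (leading_cols_count TYPE('a) n (Suc m) (Suc r)) =
      q ^ Suc r * int (leading_cols_count TYPE('a) n m (Suc r))
      + (q ^ n - q ^ r) * int (leading_cols_count TYPE('a) n m r)"
proof -
  let ?M = "carrier_mat n n :: 'a mat set"
  let ?rk = "vec_space.rank n :: 'a mat \<Rightarrow> nat"
  let ?P = "\<lambda>A :: 'a mat. \<forall>j. Suc m \<le> j \<and> j < n \<longrightarrow> col A j = 0\<^sub>v n"
  let ?T = "{A \<in> ?M. col A m = 0\<^sub>v n \<and> ?P A}"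
  have fin: "finite ?T" by (rule finite_subset[OF _ finite_carrier_mat[of n n]]) auto
  have T: "?T = {A \<in> ?M. \<forall>j. m \<le> j \<and> j < n \<longrightarrow> col A j = 0\<^sub>v n}"
  proof -
    have "m \<le> j \<longleftrightarrow> j = m \<or> Suc m \<le> j" for j by auto
    then have "(col A m = 0\<^sub>v n \<and> ?P A) \<longleftrightarrow> (\<forall>j. m \<le> j \<and> j < n \<longrightarrow> col A j = 0\<^sub>v n)" for A
      using m by metis
    then show ?thesis by (simp only:)
  qed
  have level: "card {A \<in> ?T. ?rk A = s} = leading_cols_count TYPE('a) n m s" for s
    unfolding T leading_cols_count_def by (rule arg_cong[of _ _ card]) blast
  have P: "?P (put_col m (0\<^sub>v n) A) \<longleftrightarrow> ?P A" if A: "A \<in> ?M" for A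
  proof -
    have "col (put_col m (0\<^sub>v n) A) j = col A j" if "Suc m \<le> j" "j < n" for j
      using A that by (intro eq_vecI) (simp_all add: put_col_def)
    then show ?thesis by simp
  qed
  have VC: "carrier_vec n \<inter> vec_space.col_space n A = vec_space.col_space n A" if "A \<in> ?M" for A
    using submodule_col_space[OF that] unfolding submodule_module_vec_iff by blast
  have cV: "int (card (carrier_vec n :: 'a vec set)) = q ^ n"
    using card_carrier_vec[of n, where 'b='a] q by simp
  have step: "int (leading_cols_count TYPE('a) n (Suc m) s) =
      (\<Sum>A\<in>?T. if ?rk A = s then q ^ s
        else if Suc (?rk A) = s then q ^ n - q ^ (s - 1) else 0)" for s
  proof -
    have "{A \<in> ?M. ?P A \<and> ?rk A = s} = {A \<in> ?M. ?P (put_col m (0\<^sub>v n) A) \<and> True \<and> ?rk A = s}"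
      using P by blast
    then have "leading_cols_count TYPE('a) n (Suc m) s =
        (\<Sum>A\<in>?T. card {c \<in> carrier_vec n. True \<and> ?rk (put_col m c A) = s})"
      unfolding leading_cols_count_def card_put_col_fibres[OF m, symmetric] by (rule arg_cong)
    then have "int (leading_cols_count TYPE('a) n (Suc m) s) =
        (\<Sum>A\<in>?T. int (card {c \<in> carrier_vec n. ?rk (put_col m c A) = s}))"
      unfolding simp_thms of_nat_sum[symmetric] by (rule arg_cong)
    also have "\<dots> = (\<Sum>A\<in>?T. if ?rk A = s then q ^ s
        else if Suc (?rk A) = s then q ^ n - q ^ (s - 1) else 0)"
    proof (rule sum.cong[OF refl])
      fix A assume "A \<in> ?T"
      then have A: "A \<in> ?M" "col A m = 0\<^sub>v n" by auto
      have cC: "int (card (vec_space.col_space n A)) = q ^ ?rk A"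
        using card_col_space[OF A(1)] q by simp
      show "int (card {c \<in> carrier_vec n. ?rk (put_col m c A) = s}) =
          (if ?rk A = s then q ^ s else if Suc (?rk A) = s then q ^ n - q ^ (s - 1) else 0)"
        unfolding card_columns_with_rank[OF A(1) m A(2) subset_refl] VC[OF A(1)] cC cV by auto
    qed
    finally show ?thesis .
  qed
  have "int (leading_cols_count TYPE('a) n (Suc m) 0) = (\<Sum>A\<in>?T. if ?rk A = 0 then 1 else 0)"
    unfolding step by (rule sum.cong) simp_all
  also have "\<dots> = int (card {A \<in> ?T. ?rk A = 0})"
    unfolding sum.inter_filter[OF fin, symmetric] by simp
  finally show "int (leading_cols_count TYPE('a) n (Suc m) 0) = int (leading_cols_count TYPE('a) n m 0)"
    unfolding level .
  have "int (leading_cols_count TYPE('a) n (Suc m) (Suc r)) =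
      (\<Sum>A\<in>?T. if ?rk A = Suc r then q ^ Suc r else if ?rk A = r then q ^ n - q ^ r else 0)"
    unfolding step by (rule sum.cong) simp_all
  also have "\<dots> = q ^ Suc r * int (card {A \<in> ?T. ?rk A = Suc r})
      + (q ^ n - q ^ r) * int (card {A \<in> ?T. ?rk A = r})"
    using fin by (intro sum_two_values) auto
  finally show "int (leading_cols_count TYPE('a) n (Suc m) (Suc r)) =
      q ^ Suc r * int (leading_cols_count TYPE('a) n m (Suc r))
      + (q ^ n - q ^ r) * int (leading_cols_count TYPE('a) n m r)"
    unfolding level .
qed

text \<open>The number of injective linear maps from a space of dimension \<open>r\<close> to one of dimension \<open>a\<close>, as a
  polynomial in \<open>q\<close>. It is the \<open>q\<close>-analogue of the falling factorial.\<close>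
definition falling_qpower :: "'a::comm_ring_1 \<Rightarrow> nat \<Rightarrow> nat \<Rightarrow> 'a" where
  "falling_qpower q a r = (\<Prod>i<r. q ^ a - q ^ i)"

lemma falling_qpower_0 [simp]: "falling_qpower q a 0 = 1"
  by (simp add: falling_qpower_def)

lemma falling_qpower_Suc: "falling_qpower q a (Suc r) = falling_qpower q a r * (q ^ a - q ^ r)"
  by (simp add: falling_qpower_def)

lemma falling_qpower_0_Suc: "falling_qpower q 0 (Suc r) = 0"
  unfolding falling_qpower_def prod.lessThan_Suc_shift by simp

lemma falling_qpower_Suc_Suc:
  "falling_qpower q (Suc a) (Suc r) = (q ^ Suc a - 1) * q ^ r * falling_qpower q a r"
proof -
  have "falling_qpower q (Suc a) (Suc r) = (q ^ Suc a - 1) * (\<Prod>i<r. q * (q ^ a - q ^ i))"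
    unfolding falling_qpower_def prod.lessThan_Suc_shift by (simp add: right_diff_distrib)
  also have "(\<Prod>i<r. q * (q ^ a - q ^ i)) = q ^ r * falling_qpower q a r"
    by (simp add: falling_qpower_def prod.distrib)
  finally show ?thesis by (simp only: mult.assoc)
qed

text \<open>Both sides satisfy the recursion of \<open>leading_cols_count_Suc\<close> in \<open>m\<close>. The identity behind the step is
  \<open>q ^ (s + 1) (q ^ m - q ^ s) + (q ^ (s + 1) - 1) q ^ s = (q ^ (m + 1) - 1) q ^ s\<close>.
  The denominator is kept on the left so that the induction stays within the integers.\<close>
lemma leading_cols_count_closed_form:
  fixes q :: int
  assumes q: "q = int (card (UNIV :: 'a::{field,finite} set))" and "m \<le> n"
  shows "int (leading_cols_count TYPE('a) n m r) * falling_qpower q r r =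
    falling_qpower q n r * falling_qpower q m r"
  using \<open>m \<le> n\<close>
proof (induction m arbitrary: r)
  case 0
  then show ?case
    by (cases r) (simp_all add: leading_cols_count_0 falling_qpower_0_Suc)
next
  case (Suc m)
  then have m: "m < n" and IH: "int (leading_cols_count TYPE('a) n m s) * falling_qpower q s s =
      falling_qpower q n s * falling_qpower q m s" for s by auto
  show ?case
  proof (cases r)
    case 0
    then show ?thesis using IH[of 0] leading_cols_count_Suc(1)[OF q m] by simp
  next
    case (Suc s)
    let ?Z = "\<lambda>s. int (leading_cols_count TYPE('a) n m s)"
    let ?F = "falling_qpower q"
    have "int (leading_cols_count TYPE('a) n (Suc m) r) * ?F r r =
        q ^ Suc s * (?Z (Suc s) * ?F (Suc s) (Suc s))
        + (q ^ n - q ^ s) * ?Z s * ?F (Suc s) (Suc s)"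
      unfolding Suc leading_cols_count_Suc(2)[OF q m] by (simp add: distrib_right mult.assoc)
    also have "\<dots> = q ^ Suc s * (?F n (Suc s) * ?F m (Suc s))
        + (q ^ n - q ^ s) * (q ^ Suc s - 1) * q ^ s * (?Z s * ?F s s)"
      unfolding IH[of "Suc s"] unfolding falling_qpower_Suc_Suc[of q s s] by (simp only: ac_simps)
    also have "\<dots> = ?F n (Suc s) * (q ^ Suc s * (?F m s * (q ^ m - q ^ s))
        + (q ^ Suc s - 1) * q ^ s * ?F m s)"
      unfolding IH[of s] falling_qpower_Suc[of q m s] falling_qpower_Suc[of q n s]
      by (simp only: algebra_simps)
    also have "\<dots> = ?F n (Suc s) * ((q ^ Suc m - 1) * q ^ s * ?F m s)"
      by (simp add: algebra_simps)
    also have "\<dots> = ?F n r * ?F (Suc m) r"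
      unfolding Suc falling_qpower_Suc_Suc[of q m s] ..
    finally show ?thesis .
  qed
qed

section \<open>The closed form in \<open>q\<close>-numbers\<close>

text \<open>Each factor is \<open>q ^ n - q ^ i = q ^ i (q - 1) [n - i]\<^sub>q\<close>, also for \<open>i > n\<close>, where the exponent
  \<open>n - i\<close> is negative.\<close>
lemma falling_qpower_eq_qnum:
  fixes q :: real
  assumes q: "1 < q"
  shows "falling_qpower q n r = q ^ (r choose 2) * (q - 1) ^ r * (\<Prod>i<r. qnum q (int n - int i))"
proof (induction r)
  case (Suc r)
  have "(q - 1) * qnum q (int n - int r) = q ^ n / q ^ r - 1"
    using q by (simp add: qnum_def power_int_diff)
  then have "q ^ n - q ^ r = q ^ r * ((q - 1) * qnum q (int n - int r))"
    using q by (simp add: right_diff_distrib)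
  moreover have "Suc r choose 2 = r + (r choose 2)"
    by (simp add: numeral_2_eq_2)
  ultimately show ?case
    by (simp add: falling_qpower_Suc Suc power_add)
qed (simp add: numeral_2_eq_2)

lemma prod_qnum_eq_qfact: "(\<Prod>i<r. qnum q (int r - int i)) = qfact q r"
proof -
  have "(\<Prod>i<r. qnum q (int r - int i)) = (\<Prod>i<r. qnum q (int (Suc (r - Suc i))))"
    by (intro prod.cong) (auto simp: of_nat_diff)
  also have "\<dots> = (\<Prod>i<r. qnum q (int (Suc i)))"
    by (rule prod.nat_diff_reindex)
  also have "\<dots> = qfact q r"
    unfolding qfact_def by (simp add: prod.atLeast1_atMost_eq)
  finally show ?thesis .
qed

lemma qfact_pos:
  assumes q: "1 < q" shows "0 < qfact q r"
  unfolding qfact_def qnum_def using q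
  by (intro prod_pos) (auto simp: power_int_of_nat intro!: divide_pos_pos one_less_power)

text \<open>The closed form for \<open>m = n\<close> is \<open>F n r\<^sup>2 / F r r\<close> with \<open>F = falling_qpower q\<close>. By
  \<open>falling_qpower_eq_qnum\<close> each of the three factors contains \<open>q ^ (r choose 2) (q - 1) ^ r\<close>, and one copy
  survives.\<close>
lemma mat0_no_diagonal_condition:
  fixes q :: real
  assumes q: "q = real (card (UNIV :: 'a::{field,finite} set))"
  shows "real (mat0 TYPE('a) n 0 r) =
    q ^ (r choose 2) * (q - 1) ^ r / qfact q r * (\<Prod>i<r. qnum q (int n - int i))\<^sup>2"
proof -
  have q1: "1 < q" using card_field_ge_2[where 'a='a] q by simp
  let ?c = "q ^ (r choose 2) * (q - 1) ^ r"
  let ?p = "\<Prod>i<r. qnum q (int n - int i)"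
  have real_F: "real_of_int (falling_qpower (int (card (UNIV :: 'a set))) a r) = falling_qpower q a r" for a
    by (simp add: falling_qpower_def q)
  have "real (mat0 TYPE('a) n 0 r) * falling_qpower q r r = falling_qpower q n r * falling_qpower q n r"
    using arg_cong[OF leading_cols_count_closed_form[OF refl order_refl, of n r, where 'a='a], of real_of_int]
    unfolding leading_cols_count_full of_int_mult real_F by simp
  then have "real (mat0 TYPE('a) n 0 r) * (?c * qfact q r) = ?c * ?p * (?c * ?p)"
    unfolding falling_qpower_eq_qnum[OF q1] prod_qnum_eq_qfact .
  moreover have "?c \<noteq> 0" using q1 by simp
  moreover have "qfact q r \<noteq> 0" using qfact_pos[OF q1, of r] by simp
  moreover have "x = c / f * p\<^sup>2" if "x * (c * f) = c * p * (c * p)" "c \<noteq> 0" "f \<noteq> 0" for x c f p :: real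
    using that by (simp add: field_simps power2_eq_square)
  ultimately show ?thesis by blast
qed

theorem proposition2p7:
  fixes q :: nat
  assumes "card (UNIV :: 'a::{field, finite} set) = q"
  shows "(\<forall>n k r. 1 \<le> n \<longrightarrow> k \<le> n \<longrightarrow>
      real (mat0 TYPE('a) (n + 1) (k + 1) (r + 1)) =
        1 / real q * real (mat0 TYPE('a) (n + 1) k (r + 1))
        + (real q ^ (r + 1) - real q ^ r) * real (mat0 TYPE('a) n k (r + 1))
        - (real q ^ r - real q powi (int r - 1)) * real (mat0 TYPE('a) n k r))
    \<and> (\<forall>n r. 1 \<le> n \<longrightarrow>
      real (mat0 TYPE('a) n 0 r) =
        real q ^ (r choose 2) * (real q - 1) ^ r / qfact (real q) r
        * (\<Prod>i<r. qnum (real q) (int n - int i))\<^sup>2)"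
proof (intro conjI allI impI)
  fix n k r :: nat
  assume "1 \<le> n" and k: "k \<le> n"
  have q0: "real q \<noteq> 0" using card_field_ge_2[where 'a='a] assms by simp
  have "int q = int (card (UNIV :: 'a set))" using assms by simp
  from arg_cong[OF mat0_recurrence_int[OF this k, of r], of real_of_int]
  have "real q * real (mat0 TYPE('a) (n + 1) (k + 1) (r + 1)) - real (mat0 TYPE('a) (n + 1) k (r + 1)) =
      (real q ^ (r + 2) - real q ^ (r + 1)) * real (mat0 TYPE('a) n k (r + 1))
      - (real q ^ (r + 1) - real q ^ r) * real (mat0 TYPE('a) n k r)"
    by simp
  moreover have "real q powi (int r - 1) = real q ^ r / real q"
    using q0 by (simp add: power_int_diff)
  moreover have "x = 1 / Q * y + (Q ^ (r + 1) - Q ^ r) * b - (Q ^ r - Q ^ r / Q) * c"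
    if "Q * x - y = (Q ^ (r + 2) - Q ^ (r + 1)) * b - (Q ^ (r + 1) - Q ^ r) * c" "Q \<noteq> 0"
    for Q x y b c :: real
  proof -
    have "Q * x = Q * (1 / Q * y + (Q ^ (r + 1) - Q ^ r) * b - (Q ^ r - Q ^ r / Q) * c)"
      using that by (simp add: algebra_simps)
    then show ?thesis using mult_left_cancel[OF \<open>Q \<noteq> 0\<close>] by blast
  qed
  ultimately show "real (mat0 TYPE('a) (n + 1) (k + 1) (r + 1)) =
      1 / real q * real (mat0 TYPE('a) (n + 1) k (r + 1))
      + (real q ^ (r + 1) - real q ^ r) * real (mat0 TYPE('a) n k (r + 1))
      - (real q ^ r - real q powi (int r - 1)) * real (mat0 TYPE('a) n k r)"
    using q0 by (simp only:)
next
  fix n r :: nat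
  show "real (mat0 TYPE('a) n 0 r) =
      real q ^ (r choose 2) * (real q - 1) ^ r / qfact (real q) r
      * (\<Prod>i<r. qnum (real q) (int n - int i))\<^sup>2"
    by (rule mat0_no_diagonal_condition) (simp add: assms)
qed

end
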